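(* Let $p_1,\dots,p_k$ be primes (not necessarily distinct). Then $\Gamma(\mathbb{Z}_{p_1}\times\mathbb{Z}_{p_2}\times\cdots\times\mathbb{Z}_{p_k})$ is $k$-partite, i.e. its vertex set can be partitioned into $k$ sets none of which contains two adjacent vertices.
   Context: For a commutative ring $R$ with identity, the zero-divisor graph $\Gamma(R)$ is the simple undirected graph whose vertices are the nonzero zero-divisors of $R$, two distinct vertices $u,v$ being adjacent iff $uv=0$. *)

theory Defs
  imports
    "HOL-Algebra.Chinese_Remainder"
    "HOL-Number_Theory.Residues"
    "Graph_Theory.Pair_Digraph"
begin

(* In a commutative ring the one-sided annihilation condition suffices.  The zero element
   satisfies it whenever the ring is nonzero; it is removed in the vertex set below. *)
definition zero_divisors :: "('a, 'm) ring_scheme \<Rightarrow> 'a set" where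
  "zero_divisors R =
     {x \<in> carrier R. \<exists>y \<in> carrier R. y \<noteq> \<zero>\<^bsub>R\<^esub> \<and> x \<otimes>\<^bsub>R\<^esub> y = \<zero>\<^bsub>R\<^esub>}"

(* A simple undirected graph is represented, as in Graph_Theory, by a loop-free digraph
   with a symmetric arc set. *)
definition zero_divisor_graph :: "('a, 'm) ring_scheme \<Rightarrow> 'a pair_pre_digraph" where
  "zero_divisor_graph R =
     (let V = zero_divisors R - {\<zero>\<^bsub>R\<^esub>}
      in \<lparr> pverts = V,
           parcs = {(u, v). u \<in> V \<and> v \<in> V \<and> u \<noteq> v \<and> u \<otimes>\<^bsub>R\<^esub> v = \<zero>\<^bsub>R\<^esub>} \<rparr>)"

lemma (in cring) pair_graph_zero_divisor_graph:
  assumes "finite (carrier R)"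
  shows "pair_graph (zero_divisor_graph R)"
proof -
  let ?G = "zero_divisor_graph R"
  have V: "pverts ?G \<subseteq> carrier R"
    by (auto simp: zero_divisor_graph_def zero_divisors_def)
  have A: "parcs ?G \<subseteq> pverts ?G \<times> pverts ?G"
    by (auto simp: zero_divisor_graph_def Let_def)
  have fV: "finite (pverts ?G)"
    using V assms by (rule finite_subset)
  have fA: "finite (parcs ?G)"
    by (rule finite_subset[OF A]) (simp add: fV)
  have sym: "sym (parcs ?G)"
    by (auto simp: zero_divisor_graph_def zero_divisors_def Let_def sym_def m_comm)
  have irr: "u \<noteq> v" if "(u, v) \<in> parcs ?G" for u v
    using that by (auto simp: zero_divisor_graph_def Let_def)
  show ?thesis
    using A fV fA sym irr
    by unfold_locales (auto simp: symmetric_def)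
qed

(* Parts may be empty: for instance the zero-divisor graph of a field has no vertices
   and is 1-partite. *)
definition k_partite :: "nat \<Rightarrow> 'a pair_pre_digraph \<Rightarrow> bool" where
  "k_partite k G \<longleftrightarrow>
     (\<exists>P :: nat \<Rightarrow> 'a set.
        (\<Union>i<k. P i) = pverts G \<and>
        disjoint_family_on P {..<k} \<and>
        (\<forall>i<k. \<forall>u \<in> P i. \<forall>v \<in> P i. (u, v) \<notin> parcs G))"

end

(* Colour a nonzero tuple by the first index at which it is nonzero.  Two tuples of the same
   colour i have a nonzero product, since the i-th factor is a domain. *)
theory Submission
  imports Defs
begin

text \<open>A vertex is a nonzero tuple, so some coordinate of it is nonzero; let its colour be one
  such index, giving at most k colours. If two vertices share colour i, both i-th coordinates are
  nonzero, and a field has no zero divisors, so their product is nonzero at i and they are not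
  adjacent. This needs products in \<open>RDirProd_list\<close> to be computed coordinatewise
  (\<open>RDirProd_list_mult_nth\<close>) and its zero to be the list of zeros.\<close>

lemma RDirProd_list_mult_nth:
  assumes "xs \<in> carrier (RDirProd_list Rs)" "ys \<in> carrier (RDirProd_list Rs)" "i < length Rs"
  shows "(xs \<otimes>\<^bsub>RDirProd_list Rs\<^esub> ys) ! i = xs ! i \<otimes>\<^bsub>Rs ! i\<^esub> ys ! i"
  using assms
proof (induction Rs arbitrary: xs ys i)
  case Nil
  then show ?case by simp
next
  case (Cons R Rs)
  from Cons.prems(1) obtain a as where xs: "xs = a # as"
    and a: "a \<in> carrier R" "as \<in> carrier (RDirProd_list Rs)"
    by (auto simp: RDirProd_list_carrier)
  from Cons.prems(2) obtain b bs where ys: "ys = b # bs"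
    and b: "b \<in> carrier R" "bs \<in> carrier (RDirProd_list Rs)"
    by (auto simp: RDirProd_list_carrier)
  have "xs \<otimes>\<^bsub>RDirProd_list (R # Rs)\<^esub> ys =
      (a \<otimes>\<^bsub>R\<^esub> b) # (as \<otimes>\<^bsub>RDirProd_list Rs\<^esub> bs)"
    \<comment> \<open>Consing is a ring homomorphism from the binary product of \<open>R\<close> and
      \<open>RDirProd_list Rs\<close>, where multiplication is componentwise.\<close>
    using ring_hom_mult[OF RDirProd_list_hom1[of R Rs], of "(a, as)" "(b, bs)"] a b
    by (simp add: xs ys RDirProd_carrier RDirProd_def DirProd_def monoid.defs)
  with Cons.IH[OF a(2) b(2)] Cons.prems(3) show ?case
    by (cases i) (auto simp: xs ys)
qed

lemma RDirProd_list_zero_eq_map: "\<zero>\<^bsub>RDirProd_list Rs\<^esub> = map zero Rs"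
  unfolding RDirProd_list_zero by (induction Rs) auto

text \<open>Primes enter the argument only through integrality of each factor, hence the statement
  for arbitrary domains.\<close>

theorem k_partite_zero_divisor_graph_RDirProd_list:
  assumes dom: "\<And>i. i < length Rs \<Longrightarrow> domain (Rs ! i)"
  shows "k_partite (length Rs) (zero_divisor_graph (RDirProd_list Rs))"
proof -
  let ?R = "RDirProd_list Rs"
  let ?G = "zero_divisor_graph ?R"
  define supp where "supp xs i \<longleftrightarrow> i < length Rs \<and> xs ! i \<noteq> \<zero>\<^bsub>Rs ! i\<^esub>" for xs i
  \<comment> \<open>\<open>LEAST\<close> picks one index from each support: a single colour per
    vertex makes the classes disjoint.\<close>
  define P where "P i = {xs \<in> pverts ?G. (LEAST j. supp xs j) = i}" for i
  have carr: "xs \<in> carrier ?R" if "xs \<in> pverts ?G" for xs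
    using that by (auto simp: zero_divisor_graph_def zero_divisors_def)
  have supp_Least: "supp xs (LEAST j. supp xs j)" if xs: "xs \<in> pverts ?G" for xs
  proof (rule LeastI_ex)
    \<comment> \<open>With equal lengths, differing from the zero list means differing at some index
      below \<open>length Rs\<close>.\<close>
    have "length xs = length Rs"
      using RDirProd_list_carrier_mem(1)[OF carr[OF xs]] .
    moreover have "xs \<noteq> map zero Rs"
      using xs by (auto simp: zero_divisor_graph_def RDirProd_list_zero_eq_map)
    ultimately show "\<exists>j. supp xs j"
      by (auto simp: supp_def list_eq_iff_nth_eq)
  qed
  have "(\<Union>i<length Rs. P i) = pverts ?G"
    using supp_Least by (auto simp: P_def supp_def)
  moreover have "disjoint_family_on P {..<length Rs}"
    by (auto simp: disjoint_family_on_def P_def)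
  moreover have "(xs, ys) \<notin> parcs ?G" if "i < length Rs" "xs \<in> P i" "ys \<in> P i" for i xs ys
  proof
    assume "(xs, ys) \<in> parcs ?G"
    then have "xs \<otimes>\<^bsub>?R\<^esub> ys = map zero Rs"
      by (auto simp: zero_divisor_graph_def Let_def RDirProd_list_zero_eq_map)
    moreover have c: "xs \<in> carrier ?R" "ys \<in> carrier ?R"
      and nz: "xs ! i \<noteq> \<zero>\<^bsub>Rs ! i\<^esub>" "ys ! i \<noteq> \<zero>\<^bsub>Rs ! i\<^esub>"
      using that carr supp_Least[of xs] supp_Least[of ys] by (simp_all add: P_def supp_def)
    ultimately have "xs ! i \<otimes>\<^bsub>Rs ! i\<^esub> ys ! i = \<zero>\<^bsub>Rs ! i\<^esub>"
      using RDirProd_list_mult_nth[OF c \<open>i < length Rs\<close>] \<open>i < length Rs\<close> by simp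
    then show False
      using domain.integral[OF dom] RDirProd_list_carrier_mem(2) c nz \<open>i < length Rs\<close> by metis
  qed
  ultimately show ?thesis
    unfolding k_partite_def by blast
qed

theorem theorem3p21:
  fixes ps :: "nat list"
  assumes "\<forall>p \<in> set ps. Factorial_Ring.prime p"
  shows "k_partite (length ps)
           (zero_divisor_graph (RDirProd_list (map (\<lambda>p. residue_ring (int p)) ps)))"
proof -
  have "domain (residue_ring (int p))" if "p \<in> set ps" for p
  proof -
    \<comment> \<open>For prime \<open>p\<close> the residue ring is a field, hence a
      domain.\<close>
    interpret residues_prime p "residue_ring (int p)"
      using assms that by unfold_locales auto
    show ?thesis by (rule domain_axioms)
  qed
  then show ?thesis
    using k_partite_zero_divisor_graph_RDirProd_list[of "map (\<lambda>p. residue_ring (int p)) ps"]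
    by simp
qed

end
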